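(* Let $\mathcal{H}$ be a $d$-dimensional Hilbert space with fixed orthonormal basis $\{|i\rangle\}_{i=0}^{d-1}$. The logarithmic coherence number $\mathcal{L}_C$ on density operators on $\mathcal{H}$ satisfies: (C1) $\mathcal{L}_C(\rho)\ge 0$ for all states $\rho$, and $\mathcal{L}_C(\rho)=0$ if and only if $\rho$ is incoherent; (C2) $\mathcal{L}_C(\Lambda(\rho))\le\mathcal{L}_C(\rho)$ for every incoherent operation $\Lambda$ and every state $\rho$; (C3) for every incoherent operation with incoherent Kraus operators $\{K_n\}$ and every state $\rho$, $\sum_n q_n\mathcal{L}_C(\rho_n)\le\mathcal{L}_C(\rho)$, where $q_n=\mathrm{Tr}(K_n\rho K_n^\dagger)$ and $\rho_n=K_n\rho K_n^\dagger/q_n$ (sum over $n$ with $q_n>0$); (C4) $\mathcal{L}_C\big(\sum_i p_i\rho_i\big)\le\sum_i p_i\mathcal{L}_C(\rho_i)$ for every ensemble $\{p_i,\rho_i\}$ of states. In particular, $\mathcal{L}_C$ is a coherence measure.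
   Context: A state is incoherent if it is diagonal in the fixed basis $\{|i\rangle\}$; $\mathcal{I}$ denotes the set of incoherent states. An incoherent operation is a completely positive trace-preserving map $\Lambda(\rho)=\sum_n K_n\rho K_n^\dagger$ with $\sum_n K_n^\dagger K_n=I$ and each Kraus operator satisfying $K_n\mathcal{I}K_n^\dagger\subseteq\mathcal{I}$ (up to normalization, i.e. $K_n\delta K_n^\dagger$ is diagonal for every diagonal $\delta$). The coherence rank $R_C(|\psi\rangle)$ of a pure state $|\psi\rangle=\sum_j\lambda_j|j\rangle$ is the number of nonzero coefficients $\lambda_j$. The logarithmic coherence rank is $\mathcal{L}_C(|\psi\rangle)=\log_2 R_C(|\psi\rangle)$, and the logarithmic coherence number of a state $\rho$ is $\mathcal{L}_C(\rho)=\min\sum_i p_i\mathcal{L}_C(|\psi_i\rangle)$, the minimum over all pure-state decompositions $\rho=\sum_i p_i|\psi_i\rangle\langle\psi_i|$. *)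

theory Defs
  imports "HOL-Analysis.Analysis"
begin

text \<open>Hilbert space C^d with d = CARD('d); the fixed basis is indexed by the finite type 'd.
  Operators are complex matrices of type complex^'d^'d.\<close>

type_synonym 'd cmat = "complex^'d^'d"
type_synonym 'd cvec = "complex^'d"

definition adj :: "'d::finite cmat \<Rightarrow> 'd cmat" where
  "adj A = (\<chi> i j. cnj (A $ j $ i))"

definition cinner :: "'d::finite cvec \<Rightarrow> 'd cvec \<Rightarrow> complex" where
  "cinner x y = (\<Sum>i\<in>UNIV. cnj (x $ i) * y $ i)"

definition psd :: "'d::finite cmat \<Rightarrow> bool" where
  "psd A \<longleftrightarrow> (\<forall>x. Im (cinner x (A *v x)) = 0 \<and> Re (cinner x (A *v x)) \<ge> 0)"

definition density :: "'d::finite cmat \<Rightarrow> bool" where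
  "density \<rho> \<longleftrightarrow> psd \<rho> \<and> trace \<rho> = 1"

definition diagonal_mat :: "'d::finite cmat \<Rightarrow> bool" where
  "diagonal_mat A \<longleftrightarrow> (\<forall>i j. i \<noteq> j \<longrightarrow> A $ i $ j = 0)"

definition incoherent :: "'d::finite cmat \<Rightarrow> bool" where
  "incoherent \<rho> \<longleftrightarrow> density \<rho> \<and> diagonal_mat \<rho>"

definition outer :: "'d::finite cvec \<Rightarrow> 'd cmat" where
  "outer \<psi> = (\<chi> i j. \<psi> $ i * cnj (\<psi> $ j))"

definition normalized :: "'d::finite cvec \<Rightarrow> bool" where
  "normalized \<psi> \<longleftrightarrow> (\<Sum>i\<in>UNIV. (cmod (\<psi> $ i))^2) = 1"

definition coherence_rank :: "'d::finite cvec \<Rightarrow> nat" where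
  "coherence_rank \<psi> = card {i. \<psi> $ i \<noteq> 0}"

definition log_coherence_rank :: "'d::finite cvec \<Rightarrow> real" where
  "log_coherence_rank \<psi> = log 2 (real (coherence_rank \<psi>))"

text \<open>A (finite) pure-state decomposition of \<rho>: list of weights p_i > 0 and unit vectors psi_i.\<close>
definition pure_decomp :: "'d::finite cmat \<Rightarrow> (real \<times> 'd cvec) list \<Rightarrow> bool" where
  "pure_decomp \<rho> ds \<longleftrightarrow>
     (\<forall>(p, \<psi>) \<in> set ds. p > 0 \<and> normalized \<psi>) \<and>
     sum_list (map fst ds) = 1 \<and>
     \<rho> = sum_list (map (\<lambda>(p, \<psi>). p *\<^sub>R outer \<psi>) ds)"

definition log_coherence_number :: "'d::finite cmat \<Rightarrow> real" where
  "log_coherence_number \<rho> =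
     Inf {sum_list (map (\<lambda>(p, \<psi>). p * log_coherence_rank \<psi>) ds) | ds. pure_decomp \<rho> ds}"

text \<open>Incoherent Kraus operator: maps every diagonal matrix to a diagonal matrix under K _ K^dagger.\<close>
definition incoherent_kraus :: "'d::finite cmat \<Rightarrow> bool" where
  "incoherent_kraus K \<longleftrightarrow> (\<forall>\<delta>. diagonal_mat \<delta> \<longrightarrow> diagonal_mat (K ** \<delta> ** adj K))"

definition incoherent_operation :: "'d::finite cmat list \<Rightarrow> bool" where
  "incoherent_operation Ks \<longleftrightarrow>
     sum_list (map (\<lambda>K. adj K ** K) Ks) = mat 1 \<and> (\<forall>K \<in> set Ks. incoherent_kraus K)"

definition apply_channel :: "'d::finite cmat list \<Rightarrow> 'd cmat \<Rightarrow> 'd cmat" where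
  "apply_channel Ks \<rho> = sum_list (map (\<lambda>K. K ** \<rho> ** adj K) Ks)"

end

(* Every positive semidefinite matrix is a finite sum of rank-one matrices v v* : peel off the
   column of a nonzero diagonal entry, the Schur complement stays positive semidefinite. Reading a
   list of unnormalised vectors as the ensemble with weights |v|^2, the logarithmic coherence number
   of rho is the infimum of the sum of |v|^2 log2 R_C(v) over all lists with sum v v* = rho.
   An incoherent Kraus operator has at most one nonzero entry in each column, so K v never has larger
   coherence rank than v, and K maps a list for rho to a list for K rho K*. With completeness,
   sum_n |K_n v|^2 = |v|^2, this gives (C2) and (C3); concatenating nearly optimal lists for the members
   of an ensemble gives (C4). For (C1), |rho_ab| is bounded by the cost of every list when a and b
   differ, and an incoherent state is a mixture of basis vectors, whose coherence rank is 1. *)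

theory Submission
  imports Defs
begin

section \<open>Positive semidefinite matrices as sums of rank-one matrices\<close>

lemma cinner_add_left: "cinner (x + y) z = cinner x z + cinner y z"
  by (simp add: cinner_def distrib_right sum.distrib)

lemma cinner_add_right: "cinner x (y + z) = cinner x y + cinner x z"
  by (simp add: cinner_def distrib_left sum.distrib)

lemma cinner_axis_left: "cinner (axis k c) y = cnj c * y $ k"
  unfolding cinner_def axis_def
  by (simp add: if_distrib[where f = cnj] if_distrib[where f = "\<lambda>z. z * _"] cong: if_cong)

lemma mult_vec_axis_nth: "(A *v axis k c) $ i = A $ i $ k * c"
  by (simp add: matrix_vector_mult_def axis_def if_distrib[where f = "\<lambda>z. _ * z"] cong: if_cong)

lemma cinner_mult_vec_axis: "cinner x (A *v axis k c) = c * (\<Sum>i\<in>UNIV. cnj (x $ i) * A $ i $ k)"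
  by (simp add: cinner_def mult_vec_axis_nth sum_distrib_left mult_ac)

lemma cinner_quadratic_add_axis:
  "cinner (x + axis k c) (A *v (x + axis k c)) = cinner x (A *v x) + cnj c * (A *v x) $ k
     + c * (\<Sum>i\<in>UNIV. cnj (x $ i) * A $ i $ k) + cnj c * c * A $ k $ k"
  unfolding matrix_vector_right_distrib cinner_add_left cinner_add_right cinner_axis_left
  by (simp add: cinner_mult_vec_axis mult_vec_axis_nth mult_ac)

lemma cinner_quadratic_axis: "cinner (axis k c) (A *v axis k c) = cnj c * c * A $ k $ k"
  using cinner_quadratic_add_axis[of 0 k c A] by (simp add: cinner_def)

lemma psd_diag: assumes "psd A" shows "Im (A $ k $ k) = 0 \<and> 0 \<le> Re (A $ k $ k)"
proof -
  have "A $ k $ k = cinner (axis k 1) (A *v axis k 1)" by (simp add: cinner_quadratic_axis)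
  then show ?thesis using assms by (simp add: psd_def)
qed

lemma psd_diag_of_real: "psd A \<Longrightarrow> A $ k $ k = of_real (Re (A $ k $ k))"
  using psd_diag[of A k] by (simp add: complex_eq_iff)

lemma cinner_quadratic_two_axes:
  "cinner (axis j 1 + axis k c) (A *v (axis j 1 + axis k c))
     = A $ j $ j + cnj c * A $ k $ j + c * A $ j $ k + cnj c * c * A $ k $ k"
  unfolding cinner_quadratic_add_axis cinner_quadratic_axis mult_vec_axis_nth
  by (simp add: axis_def if_distrib[where f = cnj] if_distrib[where f = "\<lambda>z. z * _"]
      cong: if_cong)

lemma psd_hermitian: assumes "psd A" shows "cnj (A $ i $ j) = A $ j $ i"
proof -
  have "Im (A $ j $ j + cnj c * A $ i $ j + c * A $ j $ i + cnj c * c * A $ i $ i) = 0" for c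
    using assms unfolding psd_def cinner_quadratic_two_axes[symmetric] by blast
  from this[of 1] this[of \<i>] psd_diag[OF assms, of i] psd_diag[OF assms, of j] show ?thesis
    by (simp add: complex_eq_iff)
qed

lemma psd_zero_diag_imp_zero_col: assumes "psd A" "A $ k $ k = 0" shows "A $ j $ k = 0"
proof (rule ccontr)
  \<comment> \<open>otherwise the quadratic form at e_j + c e_k is -1 for a suitable c\<close>
  define z where "z = A $ j $ k"
  assume "A $ j $ k \<noteq> 0"
  then have "z \<noteq> 0" by (simp add: z_def)
  define t where "t = (Re (A $ j $ j) + 1) / (2 * (cmod z)^2)"
  define c where "c = - of_real t * cnj z"
  have "c * z = - of_real (t * (cmod z)^2)"
    by (simp add: c_def mult_ac flip: complex_norm_square)
  moreover have "t * (cmod z)^2 = (Re (A $ j $ j) + 1) / 2"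
    using \<open>z \<noteq> 0\<close> by (simp add: t_def)
  moreover have "cinner (axis j 1 + axis k c) (A *v (axis j 1 + axis k c))
                   = A $ j $ j + cnj (c * z) + c * z"
    unfolding cinner_quadratic_two_axes assms(2)
    by (simp add: z_def flip: psd_hermitian[OF assms(1), of j k])
  ultimately have "Re (cinner (axis j 1 + axis k c) (A *v (axis j 1 + axis k c))) = -1"
    by simp
  with assms(1) show False unfolding psd_def by (metis neg_0_le_iff_le not_one_le_zero)
qed

lemma cinner_diff_right: "cinner x (y - z) = cinner x y - cinner x z"
  by (simp add: cinner_def right_diff_distrib sum_subtractf)

lemma cinner_outer: "cinner x (outer v *v x) = cnj (cinner v x) * cinner v x"
proof -
  have "(outer v *v x) $ i = v $ i * cinner v x" for i
    by (simp add: outer_def matrix_vector_mult_def cinner_def sum_distrib_left mult_ac)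
  then show ?thesis by (simp add: cinner_def cnj_sum sum_distrib_right mult_ac)
qed

lemma psd_diff_outer_column:
  assumes A: "psd A" and a: "A $ k $ k = of_real a" "a > 0"
  shows "psd (A - outer (\<chi> i. A $ i $ k / of_real (sqrt a)))" (is "psd (A - outer ?v)")
  unfolding psd_def
proof
  fix x
  define b where "b = (A *v x) $ k"
  define s where "s = complex_of_real (sqrt a)"
  have s: "s * s = of_real a" "s \<noteq> 0" "cnj s = s"
    using a(2) by (simp_all add: s_def flip: of_real_mult)
  have v_x: "cinner ?v x = b / s"
    using s(3) by (simp add: cinner_def b_def matrix_vector_mult_def psd_hermitian[OF A]
        sum_divide_distrib flip: s_def)
  have col: "(\<Sum>i\<in>UNIV. cnj (x $ i) * A $ i $ k) = cnj b"
    by (simp add: b_def matrix_vector_mult_def cnj_sum psd_hermitian[OF A] mult_ac)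
  \<comment> \<open>Schur complement: the form of A - v v* at x is the form of A at x - (b/a) e_k\<close>
  have "cinner x ((A - outer ?v) *v x) = cinner x (A *v x) - cnj b * b / of_real a"
    unfolding matrix_vector_mult_diff_rdistrib cinner_diff_right cinner_outer v_x
    using s by (simp add: field_simps)
  also have "\<dots> = cinner (x + axis k (- b / of_real a)) (A *v (x + axis k (- b / of_real a)))"
    unfolding cinner_quadratic_add_axis col a(1) b_def[symmetric] using a(2) by (simp add: field_simps)
  finally show "Im (cinner x ((A - outer ?v) *v x)) = 0 \<and> 0 \<le> Re (cinner x ((A - outer ?v) *v x))"
    using A unfolding psd_def by metis
qed

lemma psd_eq_0_if_diag_eq_0: "psd A \<Longrightarrow> (\<And>k. A $ k $ k = 0) \<Longrightarrow> A = 0"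
  by (simp add: vec_eq_iff psd_zero_diag_imp_zero_col)

lemma psd_sum_outer: "psd A \<Longrightarrow> \<exists>vs. sum_list (map outer vs) = A"
proof (induction "card {k. A $ k $ k \<noteq> 0}" arbitrary: A rule: less_induct)
  case less
  show ?case
  proof (cases "\<forall>k. A $ k $ k = 0")
    case True
    then show ?thesis using psd_eq_0_if_diag_eq_0[OF less.prems] by (intro exI[of _ "[]"]) simp
  next
    case False
    then obtain k where k: "A $ k $ k \<noteq> 0" by blast
    define a where "a = Re (A $ k $ k)"
    have ak: "A $ k $ k = of_real a"
      unfolding a_def by (rule psd_diag_of_real[OF less.prems])
    have "a \<ge> 0"
      using psd_diag[OF less.prems, of k] by (simp add: a_def)
    with k ak have "a > 0" by auto
    define v where "v = (\<chi> i. A $ i $ k / of_real (sqrt a))"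
    have psd: "psd (A - outer v)"
      unfolding v_def by (rule psd_diff_outer_column[OF less.prems ak \<open>a > 0\<close>])
    have "{j. (A - outer v) $ j $ j \<noteq> 0} \<subseteq> {j. A $ j $ j \<noteq> 0} - {k}"
    proof -
      have "(A - outer v) $ k $ k = 0"
        using \<open>a > 0\<close> by (simp add: v_def outer_def ak flip: of_real_mult)
      moreover have "(A - outer v) $ j $ j = 0" if "A $ j $ j = 0" for j
        using psd_zero_diag_imp_zero_col[OF less.prems that, of k]
          psd_hermitian[OF less.prems, of j k] by (simp add: v_def outer_def that)
      ultimately show ?thesis by blast
    qed
    then have "card {j. (A - outer v) $ j $ j \<noteq> 0} \<le> card ({j. A $ j $ j \<noteq> 0} - {k})"
      by (simp add: card_mono)
    also have "\<dots> < card {j. A $ j $ j \<noteq> 0}"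
      using k by (intro card_Diff1_less) auto
    finally have "card {j. (A - outer v) $ j $ j \<noteq> 0} < card {j. A $ j $ j \<noteq> 0}" .
    with less.hyps psd obtain vs where "sum_list (map outer vs) = A - outer v" by blast
    then show ?thesis by (intro exI[of _ "v # vs"]) simp
  qed
qed

section \<open>The logarithmic coherence number as an infimum over vector lists\<close>

lemma power2_norm_vec: "(norm (v :: 'd::finite cvec))^2 = (\<Sum>i\<in>UNIV. (cmod (v $ i))^2)"
  by (simp add: norm_vec_def L2_set_def sum_nonneg)

lemma normalized_iff_norm_eq_1: "normalized \<psi> \<longleftrightarrow> norm \<psi> = 1"
  by (simp add: normalized_def norm_vec_def L2_set_def)

lemma outer_scaleR: "outer (c *\<^sub>R v) = c^2 *\<^sub>R outer v"
  by (simp add: outer_def vec_eq_iff) (simp add: scaleR_conv_of_real power2_eq_square mult_ac)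

lemma sum_outer_scaleR: "sum_list (map outer (map ((*\<^sub>R) c) vs)) = c^2 *\<^sub>R sum_list (map outer vs)"
  by (induction vs) (simp_all add: outer_scaleR scaleR_add_right)

lemma outer_zero [simp]: "outer 0 = 0"
  by (simp add: outer_def vec_eq_iff)

lemma trace_outer: "trace (outer v) = of_real ((norm v)^2)"
  by (simp add: trace_def outer_def power2_norm_vec flip: complex_norm_square)

lemma trace_zero [simp]: "trace (0 :: 'd::finite cmat) = 0"
  by (simp add: trace_def)

lemma trace_sum_list: "trace (sum_list (As :: 'd::finite cmat list)) = (\<Sum>A\<leftarrow>As. trace A)"
  by (induction As) (simp_all add: trace_add)

lemma trace_sum_outer: "trace (sum_list (map outer vs)) = of_real (\<Sum>v\<leftarrow>vs. (norm v)^2)"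
  by (induction vs) (simp_all add: trace_add trace_outer)

lemma log_coherence_rank_scaleR: "c \<noteq> 0 \<Longrightarrow> log_coherence_rank (c *\<^sub>R v) = log_coherence_rank v"
  by (simp add: log_coherence_rank_def coherence_rank_def)

lemma log_coherence_rank_nonneg: "log_coherence_rank v \<ge> 0"
  by (cases "coherence_rank v = 0") (simp_all add: log_coherence_rank_def log_def)

lemma log_coherence_rank_eq_0: "coherence_rank v \<le> 1 \<Longrightarrow> log_coherence_rank v = 0"
  by (cases "coherence_rank v = 0") (simp_all add: log_coherence_rank_def log_def le_Suc_eq)

text \<open>A list of vectors v encodes the pure-state decomposition with weights |v|^2 and states v/|v|;
  zero vectors contribute nothing.\<close>

definition coherence_cost :: "'d::finite cvec list \<Rightarrow> real" where
  "coherence_cost vs = (\<Sum>v\<leftarrow>vs. (norm v)^2 * log_coherence_rank v)"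

lemma coherence_cost_nonneg: "coherence_cost vs \<ge> 0"
  unfolding coherence_cost_def by (rule sum_list_nonneg) (auto simp: log_coherence_rank_nonneg)

lemma sum_list_concat: "sum_list (concat xss) = (\<Sum>xs\<leftarrow>xss. sum_list xs)"
  by (induction xss) simp_all

lemma coherence_cost_concat: "coherence_cost (concat vss) = (\<Sum>vs\<leftarrow>vss. coherence_cost vs)"
  by (simp add: coherence_cost_def map_concat sum_list_concat o_def)

lemma coherence_cost_scaleR: "coherence_cost (map ((*\<^sub>R) c) vs) = c^2 * coherence_cost vs"
proof (cases "c = 0")
  case False
  then show ?thesis
    by (induction vs)
      (simp_all add: coherence_cost_def log_coherence_rank_scaleR power_mult_distrib distrib_left)
qed (simp add: coherence_cost_def o_def)

lemma pure_decomp_imp_sum_outer: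
  assumes "pure_decomp \<rho> ds"
  shows "\<exists>vs. sum_list (map outer vs) = \<rho>
           \<and> coherence_cost vs = sum_list (map (\<lambda>(p, \<psi>). p * log_coherence_rank \<psi>) ds)"
proof (intro exI conjI)
  let ?vs = "map (\<lambda>(p, \<psi>). sqrt p *\<^sub>R \<psi>) ds"
  have ds: "\<forall>(p, \<psi>)\<in>set ds. p > 0 \<and> norm \<psi> = 1"
    using assms by (simp add: pure_decomp_def normalized_iff_norm_eq_1)
  have outers: "map outer ?vs = map (\<lambda>(p, \<psi>). p *\<^sub>R outer \<psi>) ds"
    using ds by (auto simp: outer_scaleR)
  show "sum_list (map outer ?vs) = \<rho>"
    unfolding outers using assms by (simp add: pure_decomp_def)
  have costs: "map (\<lambda>v. (norm v)^2 * log_coherence_rank v) ?vs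
          = map (\<lambda>(p, \<psi>). p * log_coherence_rank \<psi>) ds"
    using ds by (auto simp: log_coherence_rank_scaleR)
  show "coherence_cost ?vs = sum_list (map (\<lambda>(p, \<psi>). p * log_coherence_rank \<psi>) ds)"
    unfolding coherence_cost_def costs ..
qed

lemma sum_outer_imp_pure_decomp:
  fixes vs :: "'d::finite cvec list"
  assumes "sum_list (map outer vs) = \<rho>" "trace \<rho> = 1"
  shows "\<exists>ds. pure_decomp \<rho> ds
           \<and> sum_list (map (\<lambda>(p, \<psi>). p * log_coherence_rank \<psi>) ds) = coherence_cost vs"
proof (intro exI conjI)
  let ?ds = "map (\<lambda>v. ((norm v)^2, (1 / norm v) *\<^sub>R v)) (filter (\<lambda>v. v \<noteq> 0) vs)"
  have drop_zeros: "sum_list (map f (filter (\<lambda>v. v \<noteq> 0) vs)) = sum_list (map f vs)"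
    if "f 0 = 0" for f :: "'d cvec \<Rightarrow> 'b::monoid_add"
    using that by (intro sum_list_map_filter) auto
  have "sum_list (map fst ?ds) = (\<Sum>v\<leftarrow>vs. (norm v)^2)"
    by (simp add: o_def drop_zeros)
  also have "\<dots> = 1"
    using assms trace_sum_outer[of vs] by simp
  finally have "sum_list (map fst ?ds) = 1" .
  moreover have outers: "map (\<lambda>(p, \<psi>). p *\<^sub>R outer \<psi>) ?ds = map outer (filter (\<lambda>v. v \<noteq> 0) vs)"
    by (simp add: outer_scaleR power_divide)
  have "sum_list (map (\<lambda>(p, \<psi>). p *\<^sub>R outer \<psi>) ?ds) = \<rho>"
    unfolding outers drop_zeros[of outer, OF outer_zero] by (fact assms(1))
  ultimately show "pure_decomp \<rho> ?ds"
    by (auto simp: pure_decomp_def normalized_iff_norm_eq_1)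
  have costs: "map (\<lambda>(p, \<psi>). p * log_coherence_rank \<psi>) ?ds
      = map (\<lambda>v. (norm v)^2 * log_coherence_rank v) (filter (\<lambda>v. v \<noteq> 0) vs)"
    by (simp add: log_coherence_rank_scaleR)
  show "sum_list (map (\<lambda>(p, \<psi>). p * log_coherence_rank \<psi>) ?ds) = coherence_cost vs"
    unfolding costs coherence_cost_def by (rule drop_zeros) simp
qed

lemma log_coherence_number_eq_Inf_coherence_cost:
  assumes "trace \<rho> = 1"
  shows "log_coherence_number \<rho> = Inf {coherence_cost vs | vs. sum_list (map outer vs) = \<rho>}"
proof -
  have "{sum_list (map (\<lambda>(p, \<psi>). p * log_coherence_rank \<psi>) ds) | ds. pure_decomp \<rho> ds}
          = {coherence_cost vs | vs. sum_list (map outer vs) = \<rho>}"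
  proof (intro equalityI subsetI)
    fix x assume "x \<in> {sum_list (map (\<lambda>(p, \<psi>). p * log_coherence_rank \<psi>) ds) | ds. pure_decomp \<rho> ds}"
    then obtain ds where "pure_decomp \<rho> ds" "x = sum_list (map (\<lambda>(p, \<psi>). p * log_coherence_rank \<psi>) ds)"
      by blast
    with pure_decomp_imp_sum_outer obtain vs where "sum_list (map outer vs) = \<rho>" "x = coherence_cost vs"
      by metis
    then show "x \<in> {coherence_cost vs | vs. sum_list (map outer vs) = \<rho>}"
      by blast
  next
    fix x assume "x \<in> {coherence_cost vs | vs. sum_list (map outer vs) = \<rho>}"
    then obtain vs where "sum_list (map outer vs) = \<rho>" "x = coherence_cost vs"
      by blast
    with sum_outer_imp_pure_decomp[OF _ assms] obtain ds
      where "pure_decomp \<rho> ds" "x = sum_list (map (\<lambda>(p, \<psi>). p * log_coherence_rank \<psi>) ds)"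
      by metis
    then show "x \<in> {sum_list (map (\<lambda>(p, \<psi>). p * log_coherence_rank \<psi>) ds) | ds. pure_decomp \<rho> ds}"
      by blast
  qed
  then show ?thesis by (simp add: log_coherence_number_def)
qed

lemma bdd_below_coherence_cost: "bdd_below {coherence_cost vs | vs. P vs}"
  by (rule bdd_belowI[of _ 0]) (auto simp: coherence_cost_nonneg)

lemma log_coherence_number_le_coherence_cost:
  assumes "sum_list (map outer vs) = \<rho>" "trace \<rho> = 1"
  shows "log_coherence_number \<rho> \<le> coherence_cost vs"
  unfolding log_coherence_number_eq_Inf_coherence_cost[OF assms(2)]
  by (rule cInf_lower[OF _ bdd_below_coherence_cost]) (use assms(1) in blast)

lemma le_log_coherence_number:
  assumes "density \<rho>" "\<And>vs. sum_list (map outer vs) = \<rho> \<Longrightarrow> c \<le> coherence_cost vs"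
  shows "c \<le> log_coherence_number \<rho>"
proof -
  obtain vs where "sum_list (map outer vs) = \<rho>"
    using psd_sum_outer assms(1) by (auto simp: density_def)
  moreover have "trace \<rho> = 1"
    using assms(1) by (simp add: density_def)
  ultimately show ?thesis
    unfolding log_coherence_number_eq_Inf_coherence_cost[OF \<open>trace \<rho> = 1\<close>]
    by (intro cInf_greatest) (auto intro: assms(2))
qed

lemma log_coherence_number_nonneg: "density \<rho> \<Longrightarrow> 0 \<le> log_coherence_number \<rho>"
  by (rule le_log_coherence_number) (simp_all add: coherence_cost_nonneg)

lemma coherence_cost_approx:
  assumes "density \<rho>" "e > 0"
  obtains vs where "sum_list (map outer vs) = \<rho>" "coherence_cost vs < log_coherence_number \<rho> + e"
proof -
  have "\<not> (\<forall>vs. sum_list (map outer vs) = \<rho> \<longrightarrow> log_coherence_number \<rho> + e \<le> coherence_cost vs)"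
  proof
    assume "\<forall>vs. sum_list (map outer vs) = \<rho> \<longrightarrow> log_coherence_number \<rho> + e \<le> coherence_cost vs"
    then have "log_coherence_number \<rho> + e \<le> log_coherence_number \<rho>"
      by (intro le_log_coherence_number[OF assms(1)]) blast
    with assms(2) show False by simp
  qed
  then obtain vs where "sum_list (map outer vs) = \<rho>" "\<not> log_coherence_number \<rho> + e \<le> coherence_cost vs"
    by blast
  then show thesis using that by simp
qed

section \<open>Faithfulness\<close>

lemma log_coherence_rank_ge_1:
  assumes "a \<noteq> b" "v $ a \<noteq> 0" "v $ b \<noteq> 0"
  shows "1 \<le> log_coherence_rank v"
proof -
  have "card {a, b} \<le> coherence_rank v"
    unfolding coherence_rank_def by (rule card_mono) (use assms in auto)
  with assms(1) show ?thesis by (simp add: log_coherence_rank_def)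
qed

lemma cmod_outer_off_diag_le:
  assumes "a \<noteq> b"
  shows "cmod (outer v $ a $ b) \<le> (norm v)^2 * log_coherence_rank v"
proof (cases "v $ a = 0 \<or> v $ b = 0")
  case False
  have "cmod (outer v $ a $ b) \<le> (norm v)^2 * 1"
    unfolding outer_def power2_eq_square
    by (simp add: norm_mult)
      (rule mult_mono[OF Finite_Cartesian_Product.norm_nth_le Finite_Cartesian_Product.norm_nth_le]; simp)
  also have "\<dots> \<le> (norm v)^2 * log_coherence_rank v"
    using log_coherence_rank_ge_1[OF assms] False by (intro mult_left_mono) auto
  finally show ?thesis .
qed (auto simp: outer_def log_coherence_rank_nonneg)

lemma cmod_off_diag_le_coherence_cost:
  assumes "a \<noteq> b"
  shows "cmod (sum_list (map outer vs) $ a $ b) \<le> coherence_cost vs"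
proof (induction vs)
  case (Cons v vs)
  have "cmod (sum_list (map outer (v # vs)) $ a $ b)
        \<le> cmod (outer v $ a $ b) + cmod (sum_list (map outer vs) $ a $ b)"
    by (simp add: norm_triangle_ineq)
  also have "\<dots> \<le> coherence_cost (v # vs)"
    using cmod_outer_off_diag_le[OF assms, of v] Cons.IH by (simp add: coherence_cost_def)
  finally show ?case .
qed (simp add: coherence_cost_def)

lemma outer_axis: "outer (axis i c) $ a $ b = (if a = i \<and> b = i then c * cnj c else 0)"
  by (simp add: outer_def axis_def)

lemma coherence_rank_axis: "coherence_rank (axis i c) \<le> 1"
proof -
  have "{j. axis i c $ j \<noteq> 0} \<subseteq> {i}" by (auto simp: axis_def)
  then have "card {j. axis i c $ j \<noteq> 0} \<le> card {i}"
    by (rule card_mono[rotated]) simp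
  then show ?thesis by (simp add: coherence_rank_def)
qed

lemma sum_outer_axis:
  "(\<Sum>i\<in>UNIV. outer (axis i (c i))) $ a $ b = (if a = b then c a * cnj (c a) else 0)"
  by (cases "a = b") (auto simp: sum_component outer_axis intro!: sum.neutral)

lemma diagonal_psd_sum_outer:
  fixes \<rho> :: "'d::finite cmat"
  assumes "psd \<rho>" "diagonal_mat \<rho>"
  shows "\<exists>vs. sum_list (map outer vs) = \<rho> \<and> (\<forall>v\<in>set vs. coherence_rank v \<le> 1)"
proof -
  obtain xs :: "'d list" where xs: "set xs = UNIV" "distinct xs"
    using finite_distinct_list[OF finite] by blast
  define c where "c i = complex_of_real (sqrt (Re (\<rho> $ i $ i)))" for i
  have "sum_list (map outer (map (\<lambda>i. axis i (c i)) xs)) $ a $ b = \<rho> $ a $ b" for a b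
  proof -
    have diag: "c a * cnj (c a) = \<rho> $ a $ a"
      using psd_diag[OF assms(1), of a] psd_diag_of_real[OF assms(1), of a]
      by (simp add: c_def flip: of_real_mult)
    have sum: "sum_list (map outer (map (\<lambda>i. axis i (c i)) xs)) = (\<Sum>i\<in>UNIV. outer (axis i (c i)))"
      by (simp add: o_def sum_list_distinct_conv_sum_set xs)
    show ?thesis
      unfolding sum sum_outer_axis using diag assms(2) by (auto simp: diagonal_mat_def)
  qed
  then show ?thesis
    using coherence_rank_axis by (intro exI[of _ "map (\<lambda>i. axis i (c i)) xs"] conjI) (auto simp: vec_eq_iff)
qed

lemma log_coherence_number_eq_0_iff:
  assumes "density \<rho>"
  shows "log_coherence_number \<rho> = 0 \<longleftrightarrow> incoherent \<rho>"
proof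
  assume "log_coherence_number \<rho> = 0"
  then have "cmod (\<rho> $ a $ b) \<le> 0" if "a \<noteq> b" for a b
    using le_log_coherence_number[OF assms] cmod_off_diag_le_coherence_cost[OF that] by metis
  then show "incoherent \<rho>"
    using assms by (simp add: incoherent_def diagonal_mat_def)
next
  assume "incoherent \<rho>"
  then obtain vs where vs: "sum_list (map outer vs) = \<rho>" "\<forall>v\<in>set vs. coherence_rank v \<le> 1"
    using diagonal_psd_sum_outer by (auto simp: incoherent_def density_def)
  then have "coherence_cost vs = 0"
    by (simp add: coherence_cost_def log_coherence_rank_eq_0 cong: map_cong)
  then show "log_coherence_number \<rho> = 0"
    using log_coherence_number_le_coherence_cost[OF vs(1)] log_coherence_number_nonneg[OF assms] assms
    by (simp add: density_def)
qed

section \<open>Incoherent operations and convexity\<close>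

lemma matrix_add_rdistrib: "(A + B) ** C = A ** C + B ** (C :: 'a::semiring_1^'n^'m)"
  by (simp add: vec_eq_iff matrix_matrix_mult_def sum.distrib distrib_right)

lemma sandwich_sum_list: "K ** sum_list As ** adj K = (\<Sum>A\<leftarrow>As. K ** A ** adj K)"
  by (induction As) (simp_all add: matrix_add_ldistrib matrix_add_rdistrib)

lemma sandwich_outer: "K ** outer \<psi> ** adj K = outer (K *v \<psi>)"
proof -
  have "(K ** outer \<psi> ** adj K) $ a $ b = outer (K *v \<psi>) $ a $ b" for a b
  proof -
    have "(K ** outer \<psi> ** adj K) $ a $ b
          = (\<Sum>m\<in>UNIV. \<Sum>l\<in>UNIV. K $ a $ l * \<psi> $ l * (cnj (\<psi> $ m) * cnj (K $ b $ m)))"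
      by (simp add: matrix_matrix_mult_def outer_def adj_def sum_distrib_right mult.assoc)
    also have "\<dots> = (\<Sum>l\<in>UNIV. \<Sum>m\<in>UNIV. K $ a $ l * \<psi> $ l * (cnj (\<psi> $ m) * cnj (K $ b $ m)))"
      by (rule sum.swap)
    also have "\<dots> = outer (K *v \<psi>) $ a $ b"
      by (simp add: outer_def matrix_vector_mult_def cnj_sum sum_product mult.commute)
    finally show ?thesis .
  qed
  then show ?thesis by (simp add: vec_eq_iff)
qed

lemma sandwich_sum_outer:
  "K ** sum_list (map outer vs) ** adj K = sum_list (map outer (map ((*v) K) vs))"
  by (simp add: sandwich_sum_list sandwich_outer o_def)

lemma trace_apply_channel:
  assumes "sum_list (map (\<lambda>K. adj K ** K) Ks) = mat 1"
  shows "trace (apply_channel Ks \<rho>) = trace \<rho>"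
proof -
  have "trace (K ** \<rho> ** adj K) = trace (\<rho> ** (adj K ** K))" for K
    by (metis matrix_mul_assoc trace_mul_sym)
  then have "trace (apply_channel Ks \<rho>) = (\<Sum>K\<leftarrow>Ks. trace (\<rho> ** (adj K ** K)))"
    by (simp add: apply_channel_def trace_sum_list o_def)
  also have "\<dots> = trace (\<rho> ** sum_list (map (\<lambda>K. adj K ** K) Ks))"
    by (induction Ks) (simp_all add: matrix_add_ldistrib trace_add)
  finally show ?thesis
    using assms by simp
qed

lemma incoherent_kraus_column:
  assumes "incoherent_kraus K" "K $ a $ j \<noteq> 0" "K $ b $ j \<noteq> 0"
  shows "a = b"
proof (rule ccontr)
  assume "a \<noteq> b"
  have "diagonal_mat (outer (axis j 1))"
    by (simp add: diagonal_mat_def outer_axis)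
  with assms(1) have "diagonal_mat (outer (K *v axis j 1))"
    by (simp add: incoherent_kraus_def flip: sandwich_outer)
  with \<open>a \<noteq> b\<close> have "K $ a $ j * cnj (K $ b $ j) = 0"
    by (simp add: diagonal_mat_def outer_def mult_vec_axis_nth)
  with assms(2,3) show False by simp
qed

lemma coherence_rank_incoherent_kraus:
  assumes "incoherent_kraus K"
  shows "coherence_rank (K *v \<psi>) \<le> coherence_rank \<psi>"
proof -
  define row_of where "row_of j = (SOME a. K $ a $ j \<noteq> 0)" for j
  have "{a. (K *v \<psi>) $ a \<noteq> 0} \<subseteq> row_of ` {j. \<psi> $ j \<noteq> 0}"
  proof
    fix a assume "a \<in> {a. (K *v \<psi>) $ a \<noteq> 0}"
    then have "(\<Sum>j\<in>UNIV. K $ a $ j * \<psi> $ j) \<noteq> 0"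
      by (simp add: matrix_vector_mult_def)
    then obtain j where j: "K $ a $ j * \<psi> $ j \<noteq> 0"
      by (meson sum.neutral)
    then have "K $ row_of j $ j \<noteq> 0"
      unfolding row_of_def by (metis (mono_tags) mult_eq_0_iff someI)
    with j have "row_of j = a"
      using incoherent_kraus_column[OF assms] by auto
    with j show "a \<in> row_of ` {j. \<psi> $ j \<noteq> 0}" by auto
  qed
  then have "coherence_rank (K *v \<psi>) \<le> card (row_of ` {j. \<psi> $ j \<noteq> 0})"
    unfolding coherence_rank_def by (rule card_mono[rotated]) simp
  also have "\<dots> \<le> coherence_rank \<psi>"
    unfolding coherence_rank_def by (rule card_image_le) simp
  finally show ?thesis .
qed

lemma log_coherence_rank_incoherent_kraus:
  assumes "incoherent_kraus K"
  shows "log_coherence_rank (K *v \<psi>) \<le> log_coherence_rank \<psi>"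
proof (cases "coherence_rank (K *v \<psi>) = 0")
  case False
  then show ?thesis
    unfolding log_coherence_rank_def
    by (intro log_mono) (simp_all add: coherence_rank_incoherent_kraus[OF assms])
qed (simp add: log_coherence_rank_eq_0 log_coherence_rank_nonneg)

lemma sum_list_swap: "(\<Sum>x\<leftarrow>xs. \<Sum>y\<leftarrow>ys. f x y) = (\<Sum>y\<leftarrow>ys. \<Sum>x\<leftarrow>xs. f x y :: 'a::comm_monoid_add)"
  by (induction xs) (simp_all add: sum_list_addf)

lemma sum_power2_norm_kraus:
  assumes "sum_list (map (\<lambda>K. adj K ** K) Ks) = mat 1"
  shows "(\<Sum>K\<leftarrow>Ks. (norm (K *v v))^2) = (norm v)^2"
proof -
  have "of_real (\<Sum>K\<leftarrow>Ks. (norm (K *v v))^2) = trace (sum_list (map outer (map (\<lambda>K. K *v v) Ks)))"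
    by (subst trace_sum_outer) (simp add: o_def)
  also have "\<dots> = trace (apply_channel Ks (outer v))"
    by (simp add: apply_channel_def sandwich_outer o_def)
  also have "\<dots> = of_real ((norm v)^2)"
    using assms by (simp add: trace_apply_channel trace_outer)
  finally show ?thesis by (simp only: of_real_eq_iff)
qed

lemma coherence_cost_channel_le:
  assumes "incoherent_operation Ks"
  shows "(\<Sum>K\<leftarrow>Ks. coherence_cost (map ((*v) K) vs)) \<le> coherence_cost vs"
proof -
  have "(\<Sum>K\<leftarrow>Ks. coherence_cost (map ((*v) K) vs))
        \<le> (\<Sum>K\<leftarrow>Ks. \<Sum>v\<leftarrow>vs. (norm (K *v v))^2 * log_coherence_rank v)"
    unfolding coherence_cost_def using assms
    by (auto simp: incoherent_operation_def o_def log_coherence_rank_incoherent_kraus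
        intro!: sum_list_mono mult_left_mono)
  also have "\<dots> = (\<Sum>v\<leftarrow>vs. (\<Sum>K\<leftarrow>Ks. (norm (K *v v))^2) * log_coherence_rank v)"
    by (subst sum_list_swap) (simp add: sum_list_mult_const)
  also have "\<dots> = coherence_cost vs"
    using assms by (simp add: incoherent_operation_def sum_power2_norm_kraus coherence_cost_def)
  finally show ?thesis .
qed

lemma log_coherence_number_apply_channel_le:
  assumes "incoherent_operation Ks" "density \<rho>"
  shows "log_coherence_number (apply_channel Ks \<rho>) \<le> log_coherence_number \<rho>"
proof (rule le_log_coherence_number[OF assms(2)])
  fix vs assume vs: "sum_list (map outer vs) = \<rho>"
  let ?ws = "concat (map (\<lambda>K. map ((*v) K) vs) Ks)"
  have "sum_list (map outer ?ws) = apply_channel Ks \<rho>"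
    unfolding apply_channel_def vs[symmetric] sandwich_sum_outer
    by (induction Ks) simp_all
  moreover have "trace (apply_channel Ks \<rho>) = 1"
    using assms by (simp add: trace_apply_channel incoherent_operation_def density_def)
  ultimately have "log_coherence_number (apply_channel Ks \<rho>) \<le> coherence_cost ?ws"
    by (rule log_coherence_number_le_coherence_cost)
  also have "\<dots> \<le> coherence_cost vs"
    using coherence_cost_channel_le[OF assms(1)] by (simp add: coherence_cost_concat o_def)
  finally show "log_coherence_number (apply_channel Ks \<rho>) \<le> coherence_cost vs" .
qed

lemma trace_scaleR: "trace (c *\<^sub>R A) = of_real c * trace (A :: 'd::finite cmat)"
  by (simp add: trace_def sum_distrib_left) (simp add: scaleR_conv_of_real)

lemma scaled_log_coherence_number_le_coherence_cost:
  assumes "sum_list (map outer ws) = \<sigma>" "Re (trace \<sigma>) > 0"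
  shows "Re (trace \<sigma>) * log_coherence_number ((1 / Re (trace \<sigma>)) *\<^sub>R \<sigma>) \<le> coherence_cost ws"
proof -
  define q where "q = Re (trace \<sigma>)"
  have q: "trace \<sigma> = of_real q" "q = (\<Sum>w\<leftarrow>ws. (norm w)^2)" "q > 0"
    using assms trace_sum_outer[of ws] by (simp_all add: q_def)
  let ?ws = "map ((*\<^sub>R) (1 / sqrt q)) ws"
  have "sum_list (map outer ?ws) = (1 / q) *\<^sub>R \<sigma>"
    unfolding sum_outer_scaleR assms(1) using q(3) by (simp add: power_divide)
  moreover have "trace ((1 / q) *\<^sub>R \<sigma>) = 1"
    using q by (simp add: trace_scaleR flip: of_real_mult)
  ultimately have "log_coherence_number ((1 / q) *\<^sub>R \<sigma>) \<le> coherence_cost ?ws"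
    by (rule log_coherence_number_le_coherence_cost)
  also have "\<dots> = coherence_cost ws / q"
    using q(3) by (simp add: coherence_cost_scaleR power_divide)
  finally show ?thesis
    using q(3) by (simp add: q_def[symmetric] field_simps)
qed

lemma log_coherence_number_kraus_average_le:
  assumes "incoherent_operation Ks" "density \<rho>"
  defines "q \<equiv> \<lambda>n. Re (trace (Ks ! n ** \<rho> ** adj (Ks ! n)))"
  shows "(\<Sum>n\<in>{n. n < length Ks \<and> q n > 0}.
            q n * log_coherence_number ((1 / q n) *\<^sub>R (Ks ! n ** \<rho> ** adj (Ks ! n))))
         \<le> log_coherence_number \<rho>"
proof (rule le_log_coherence_number[OF assms(2)])
  fix vs assume vs: "sum_list (map outer vs) = \<rho>"
  let ?cost = "\<lambda>n. coherence_cost (map ((*v) (Ks ! n)) vs)"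
  have "q n * log_coherence_number ((1 / q n) *\<^sub>R (Ks ! n ** \<rho> ** adj (Ks ! n))) \<le> ?cost n"
    if "q n > 0" for n
    using scaled_log_coherence_number_le_coherence_cost[of "map ((*v) (Ks ! n)) vs"] that
    unfolding q_def vs[symmetric] sandwich_sum_outer by simp
  then have "(\<Sum>n\<in>{n. n < length Ks \<and> q n > 0}.
                q n * log_coherence_number ((1 / q n) *\<^sub>R (Ks ! n ** \<rho> ** adj (Ks ! n))))
             \<le> (\<Sum>n\<in>{n. n < length Ks \<and> q n > 0}. ?cost n)"
    by (intro sum_mono) auto
  also have "\<dots> \<le> (\<Sum>n<length Ks. ?cost n)"
    by (intro sum_mono2) (auto simp: coherence_cost_nonneg)
  also have "\<dots> = (\<Sum>K\<leftarrow>Ks. coherence_cost (map ((*v) K) vs))"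
    by (simp add: sum_list_sum_nth atLeast0LessThan)
  also have "\<dots> \<le> coherence_cost vs"
    by (rule coherence_cost_channel_le[OF assms(1)])
  finally show "(\<Sum>n\<in>{n. n < length Ks \<and> q n > 0}.
                  q n * log_coherence_number ((1 / q n) *\<^sub>R (Ks ! n ** \<rho> ** adj (Ks ! n))))
                \<le> coherence_cost vs" .
qed

lemma log_coherence_number_convex:
  fixes ens :: "(real \<times> 'd::finite cmat) list"
  assumes ens: "\<forall>(p, \<sigma>) \<in> set ens. p \<ge> 0 \<and> density \<sigma>" and sum_p: "sum_list (map fst ens) = 1"
  shows "log_coherence_number (sum_list (map (\<lambda>(p, \<sigma>). p *\<^sub>R \<sigma>) ens))
           \<le> sum_list (map (\<lambda>(p, \<sigma>). p * log_coherence_number \<sigma>) ens)"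
proof (rule field_le_epsilon)
  fix e :: real assume "e > 0"
  define V where "V \<sigma> = (SOME vs. sum_list (map outer vs) = \<sigma>
                              \<and> coherence_cost vs < log_coherence_number \<sigma> + e)" for \<sigma> :: "'d cmat"
  have V: "sum_list (map outer (V \<sigma>)) = \<sigma> \<and> coherence_cost (V \<sigma>) < log_coherence_number \<sigma> + e"
    if "density \<sigma>" for \<sigma>
    unfolding V_def by (rule someI_ex) (meson coherence_cost_approx[OF that \<open>e > 0\<close>])
  define W where "W x = map ((*\<^sub>R) (sqrt (fst x))) (V (snd x))" for x :: "real \<times> 'd cmat"
  have W: "sum_list (map outer (W x)) = fst x *\<^sub>R snd x"
    "coherence_cost (W x) = fst x * coherence_cost (V (snd x))" if "x \<in> set ens" for x
  proof -
    from ens that have "fst x \<ge> 0" "density (snd x)"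
      by (auto simp: case_prod_unfold)
    then show "sum_list (map outer (W x)) = fst x *\<^sub>R snd x"
      "coherence_cost (W x) = fst x * coherence_cost (V (snd x))"
      unfolding W_def sum_outer_scaleR coherence_cost_scaleR using V by simp_all
  qed
  have "sum_list (map outer (concat (map W ens))) = sum_list (map (\<lambda>(p, \<sigma>). p *\<^sub>R \<sigma>) ens)"
    unfolding map_concat sum_list_concat map_map o_def case_prod_unfold
    by (rule arg_cong[where f = sum_list], rule map_cong) (simp_all add: W(1))
  moreover have "trace (sum_list (map (\<lambda>(p, \<sigma>). p *\<^sub>R \<sigma>) ens)) = of_real (sum_list (map fst ens))"
    using ens by (induction ens) (auto simp: trace_add trace_scaleR density_def)
  ultimately have "log_coherence_number (sum_list (map (\<lambda>(p, \<sigma>). p *\<^sub>R \<sigma>) ens))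
                   \<le> coherence_cost (concat (map W ens))"
    using sum_p by (intro log_coherence_number_le_coherence_cost) auto
  also have "\<dots> = (\<Sum>x\<leftarrow>ens. fst x * coherence_cost (V (snd x)))"
    unfolding coherence_cost_concat map_map o_def
    by (rule arg_cong[where f = sum_list], rule map_cong) (simp_all add: W(2))
  also have "\<dots> \<le> (\<Sum>x\<leftarrow>ens. fst x * log_coherence_number (snd x) + e * fst x)"
  proof (rule sum_list_mono)
    fix x assume "x \<in> set ens"
    with ens have "fst x \<ge> 0" "density (snd x)"
      by (auto simp: case_prod_unfold)
    with V have "fst x * coherence_cost (V (snd x)) \<le> fst x * (log_coherence_number (snd x) + e)"
      by (intro mult_left_mono) (auto intro: less_imp_le)
    then show "fst x * coherence_cost (V (snd x)) \<le> fst x * log_coherence_number (snd x) + e * fst x"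
      by (simp add: algebra_simps)
  qed
  also have "\<dots> = (\<Sum>(p, \<sigma>)\<leftarrow>ens. p * log_coherence_number \<sigma>) + e"
    using sum_p by (simp add: case_prod_unfold sum_list_addf sum_list_const_mult)
  finally show "log_coherence_number (sum_list (map (\<lambda>(p, \<sigma>). p *\<^sub>R \<sigma>) ens))
                  \<le> (\<Sum>(p, \<sigma>)\<leftarrow>ens. p * log_coherence_number \<sigma>) + e" .
qed

theorem proposition2:
  fixes dummy :: "'d::finite itself"
  shows
   "(\<forall>\<rho> :: 'd cmat. density \<rho> \<longrightarrow>
        log_coherence_number \<rho> \<ge> 0 \<and> (log_coherence_number \<rho> = 0 \<longleftrightarrow> incoherent \<rho>))
    \<and> (\<forall>(Ks :: 'd cmat list) \<rho>. incoherent_operation Ks \<and> density \<rho> \<longrightarrow>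
        log_coherence_number (apply_channel Ks \<rho>) \<le> log_coherence_number \<rho>)
    \<and> (\<forall>(Ks :: 'd cmat list) \<rho>. incoherent_operation Ks \<and> density \<rho> \<longrightarrow>
        (let q = (\<lambda>n. Re (trace (Ks ! n ** \<rho> ** adj (Ks ! n)))) in
         (\<Sum>n\<in>{n. n < length Ks \<and> q n > 0}.
            q n * log_coherence_number ((1 / q n) *\<^sub>R (Ks ! n ** \<rho> ** adj (Ks ! n))))
         \<le> log_coherence_number \<rho>))
    \<and> (\<forall>ens :: (real \<times> 'd cmat) list.
        (\<forall>(p, \<sigma>) \<in> set ens. p \<ge> 0 \<and> density \<sigma>) \<and> sum_list (map fst ens) = 1 \<longrightarrow>
        log_coherence_number (sum_list (map (\<lambda>(p, \<sigma>). p *\<^sub>R \<sigma>) ens))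
          \<le> sum_list (map (\<lambda>(p, \<sigma>). p * log_coherence_number \<sigma>) ens))"
  using log_coherence_number_nonneg log_coherence_number_eq_0_iff
    log_coherence_number_apply_channel_le log_coherence_number_kraus_average_le
    log_coherence_number_convex
  unfolding Let_def by blast

end
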